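(* Let $A=U\Sigma U^\top$, where $U\in\mathbb{R}^{n\times n}$ is orthogonal and $\Sigma=\operatorname{diag}(\sigma_1,\ldots,\sigma_n)$ with $\sigma_1\ge\cdots\ge\sigma_n\ge0$. Let $u_i\in\mathbb{R}^n$ denote the $i$th row of $U$. Let $I=(i_1,\ldots,i_k)$ be a tuple of indices in $\{1,\ldots,n\}$, assume $A(I,I)$ is nonsingular, and let $P_k$ be the projection onto the first $k$ coordinates. Let $X\in\mathbb{R}^{n\times k}$ be the matrix whose $p$th column is $u_{i_p}$ (written as a column vector), and let $U^{(0)}=P_kX\in\mathbb{R}^{k\times k}$ be the matrix consisting of the first $k$ rows of $X$. If $U^{(0)}$ is nonsingular, then $$\operatorname{tr}\left(A-A(:,I)A(I,I)^{-1}A(I,:)\right)\le(n-k)\left(1+\|(U^{(0)})^{-1}\|_2\right)^2\sum_{q=k+1}^n\sigma_q.$$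
   Context: $\|\cdot\|_2$ of a matrix is the spectral (operator) norm. $A(:,I)$ and $A(I,:)$ are the selected columns and rows of $A$; $A(I,I)$ is the $k\times k$ matrix with entries $A_{i_ai_b}$. *)

theory Defs
  imports Complex_Main "Jordan_Normal_Form.Gauss_Jordan_Elimination"
begin

(* Rows, columns and index tuples are numbered from 0, as in Jordan_Normal_Form.Matrix. *)

(* The library's orthogonal_mat only requires the columns to be nonzero and pairwise
   orthogonal, not of length 1. *)
definition real_orthogonal_mat :: "nat \<Rightarrow> real mat \<Rightarrow> bool" where
  "real_orthogonal_mat n U \<longleftrightarrow>
     U \<in> carrier_mat n n \<and> U\<^sup>T * U = 1\<^sub>m n \<and> U * U\<^sup>T = 1\<^sub>m n"

definition mat_trace :: "real mat \<Rightarrow> real" where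
  "mat_trace M = (\<Sum>i<dim_row M. M $$ (i, i))"

(* Meaningful for invertible M only; otherwise the value is unspecified. *)
definition mat_inv :: "real mat \<Rightarrow> real mat" where
  "mat_inv M = the (mat_inverse M)"

definition vec_norm2 :: "real vec \<Rightarrow> real" where
  "vec_norm2 v = sqrt (v \<bullet> v)"

(* Taking the closed unit ball rather than the unit sphere keeps the set nonempty when M
   has no columns; the norm is then 0. *)
definition spectral_norm :: "real mat \<Rightarrow> real" where
  "spectral_norm M =
     (SUP x\<in>{x \<in> carrier_vec (dim_col M). vec_norm2 x \<le> 1}. vec_norm2 (M *\<^sub>v x))"

(* A(:,I), A(I,:) and A(I,I) for a tuple I, given as a list; order and repetitions count. *)
definition select_cols :: "real mat \<Rightarrow> nat list \<Rightarrow> real mat" where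
  "select_cols A I = mat (dim_row A) (length I) (\<lambda>(i, b). A $$ (i, I ! b))"

definition select_rows :: "real mat \<Rightarrow> nat list \<Rightarrow> real mat" where
  "select_rows A I = mat (length I) (dim_col A) (\<lambda>(a, j). A $$ (I ! a, j))"

definition select_both :: "real mat \<Rightarrow> nat list \<Rightarrow> real mat" where
  "select_both A I = mat (length I) (length I) (\<lambda>(a, b). A $$ (I ! a, I ! b))"

(* P_k as a map from n-space to k-space, i.e. a k x n matrix. *)
definition coord_proj :: "nat \<Rightarrow> nat \<Rightarrow> real mat" where
  "coord_proj k n = mat k n (\<lambda>(i, j). if i = j then 1 else 0)"

end

theory Submission
  imports Defs "HOL-Analysis.L2_Norm"
begin

text \<open>
  The diagonal entries of the Schur complement \<open>S = A - A(:,I) A(I,I)\<inverse> A(I,:)\<close> are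
  least-squares errors. Write \<open>u\<^sub>j\<close> for the \<open>j\<close>-th row of \<open>U\<close> and \<open>D\<close> for the diagonal matrix of
  the \<open>\<sigma>\<^sub>q\<close>, so that \<open>A\<close> is the Gram matrix of the rows of \<open>U\<close> for the form
  \<open>\<langle>x, y\<rangle> = x \<bullet> D y\<close>, and \<open>A(I,I) = X\<^sup>T D X\<close>. Then \<open>S\<^sub>j\<^sub>j\<close> is the minimum over \<open>c\<close> of the quadratic
  form of \<open>D\<close> at \<open>u\<^sub>j - X c\<close>, attained where the normal equations hold; only the upper bound
  \<open>S\<^sub>j\<^sub>j \<le> (u\<^sub>j - X c) \<bullet> D (u\<^sub>j - X c)\<close> for every \<open>c\<close> is needed (lemma \<open>schur_complement_diag_le\<close>).

  If \<open>j\<close> occurs in \<open>I\<close>, then \<open>u\<^sub>j\<close> is a column of \<open>X\<close>, and a unit vector \<open>c\<close> gives \<open>S\<^sub>j\<^sub>j \<le> 0\<close>. This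
  leaves \<open>n - k\<close> indices, because nonsingularity of \<open>A(I,I)\<close> forces the entries of \<open>I\<close> to be
  distinct. For any \<open>j\<close> take \<open>c = U0\<inverse> P\<^sub>k u\<^sub>j\<close>, where \<open>U0 = P\<^sub>k X\<close>. Then \<open>u\<^sub>j - X c\<close> vanishes in its
  first \<open>k\<close> coordinates. As \<open>u\<^sub>j\<close> is a unit vector and the columns of \<open>X\<close> are orthonormal, its norm
  is at most \<open>1 + \<parallel>X c\<parallel> = 1 + \<parallel>c\<parallel> \<le> 1 + \<parallel>U0\<inverse>\<parallel>\<close> (lemma \<open>interpolating_coefficients\<close>). Bounding
  each remaining coordinate by this norm yields
  \<open>S\<^sub>j\<^sub>j \<le> (1 + \<parallel>U0\<inverse>\<parallel>)\<^sup>2 (\<sigma>\<^sub>k + \<dots> + \<sigma>\<^sub>n\<^sub>-\<^sub>1)\<close>, with indices counted from \<open>0\<close>.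
\<close>

section \<open>The Euclidean and the spectral norm\<close>

lemma vec_norm2_L2_set: "vec_norm2 v = L2_set (\<lambda>i. v $ i) {..<dim_vec v}"
  by (simp add: vec_norm2_def L2_set_def scalar_prod_def power2_eq_square atLeast0LessThan)

lemma vec_norm2_nonneg: "0 \<le> vec_norm2 v"
  by (simp add: vec_norm2_L2_set)

lemma vec_norm2_minus_le:
  assumes "v \<in> carrier_vec n" and "w \<in> carrier_vec n"
  shows "vec_norm2 (v - w) \<le> vec_norm2 v + vec_norm2 w"
proof -
  have "vec_norm2 (v - w) = L2_set (\<lambda>i. v $ i + - w $ i) {..<n}"
    unfolding vec_norm2_L2_set using assms by (intro L2_set_cong) auto
  also have "\<dots> \<le> L2_set (\<lambda>i. v $ i) {..<n} + L2_set (\<lambda>i. - w $ i) {..<n}"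
    by (rule L2_set_triangle_ineq)
  also have "L2_set (\<lambda>i. - w $ i) {..<n} = L2_set (\<lambda>i. w $ i) {..<n}"
    by (simp add: L2_set_def)
  finally show ?thesis
    using assms by (simp add: vec_norm2_L2_set)
qed

lemma square_entry_le_vec_norm2:
  assumes "i < dim_vec v"
  shows "(v $ i)\<^sup>2 \<le> (vec_norm2 v)\<^sup>2"
proof -
  have "\<bar>v $ i\<bar> \<le> L2_set (\<lambda>i. \<bar>v $ i\<bar>) {..<dim_vec v}"
    by (rule member_le_L2_set) (use assms in auto)
  then have "\<bar>v $ i\<bar> \<le> vec_norm2 v"
    by (simp add: vec_norm2_L2_set L2_set_def)
  then show ?thesis
    by (rule abs_le_square_iff[THEN iffD1, OF order_trans]) simp
qed

lemma abs_scalar_prod_le: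
  assumes "dim_vec v = dim_vec w"
  shows "\<bar>v \<bullet> w\<bar> \<le> vec_norm2 v * vec_norm2 w"
proof -
  have "\<bar>v \<bullet> w\<bar> \<le> (\<Sum>i<dim_vec w. \<bar>v $ i\<bar> * \<bar>w $ i\<bar>)"
    unfolding scalar_prod_def atLeast0LessThan abs_mult[symmetric] by (rule sum_abs)
  also have "\<dots> \<le> vec_norm2 v * vec_norm2 w"
    unfolding vec_norm2_L2_set assms by (rule L2_set_mult_ineq)
  finally show ?thesis .
qed

text \<open>
  On the unit ball, \<open>\<parallel>M x\<parallel>\<close> is bounded by the sum of the norms of the rows of \<open>M\<close>, so the supremum
  defining the spectral norm is a genuine one.
\<close>

lemma bdd_above_spectral:
  "bdd_above ((\<lambda>x. vec_norm2 (M *\<^sub>v x)) ` {x \<in> carrier_vec (dim_col M). vec_norm2 x \<le> 1})"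
proof (rule bdd_aboveI2)
  fix x assume "x \<in> {x \<in> carrier_vec (dim_col M). vec_norm2 x \<le> 1}"
  then have x: "dim_vec x = dim_col M" "vec_norm2 x \<le> 1" by auto
  have "vec_norm2 (M *\<^sub>v x) \<le> (\<Sum>i<dim_row M. \<bar>(M *\<^sub>v x) $ i\<bar>)"
    using L2_set_le_sum_abs[of "\<lambda>i. (M *\<^sub>v x) $ i" "{..<dim_row M}"]
    by (simp add: vec_norm2_L2_set)
  also have "\<dots> \<le> (\<Sum>i<dim_row M. vec_norm2 (row M i))"
  proof (rule sum_mono)
    fix i assume "i \<in> {..<dim_row M}"
    then have "\<bar>(M *\<^sub>v x) $ i\<bar> \<le> vec_norm2 (row M i) * vec_norm2 x"
      using abs_scalar_prod_le[of "row M i" x] x by simp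
    also have "\<dots> \<le> vec_norm2 (row M i)"
      using x by (simp add: mult_left_le vec_norm2_nonneg)
    finally show "\<bar>(M *\<^sub>v x) $ i\<bar> \<le> vec_norm2 (row M i)" .
  qed
  finally show "vec_norm2 (M *\<^sub>v x) \<le> (\<Sum>i<dim_row M. vec_norm2 (row M i))" .
qed

lemma vec_norm2_mult_le_spectral_norm:
  assumes x: "x \<in> carrier_vec (dim_col M)" and le: "vec_norm2 x \<le> 1"
  shows "vec_norm2 (M *\<^sub>v x) \<le> spectral_norm M"
  unfolding spectral_norm_def
  by (rule cSUP_upper[OF _ bdd_above_spectral]) (use assms in auto)

section \<open>Inverses and Gram matrices\<close>

lemma mat_inv_correct:
  assumes A: "A \<in> carrier_mat n n" and inv: "invertible_mat A"
  shows "mat_inv A \<in> carrier_mat n n" "A * mat_inv A = 1\<^sub>m n" "mat_inv A * A = 1\<^sub>m n"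
proof -
  obtain B where B: "A * B = 1\<^sub>m n" "B * A = 1\<^sub>m (dim_row B)"
    using A inv unfolding invertible_mat_def inverts_mat_def by auto
  have "dim_col B = n" using arg_cong[OF B(1), of dim_col] by simp
  moreover have "dim_row B = n" using arg_cong[OF B(2), of dim_col] A by simp
  ultimately have "B \<in> carrier_mat n n" by auto
  then have "A \<in> Units (ring_mat TYPE(real) n ())"
    using A B by (auto simp: Units_def ring_mat_def intro!: bexI[of _ B])
  then obtain C where "mat_inverse A = Some C"
    using mat_inverse(1)[OF A, of "()"] by (cases "mat_inverse A") auto
  then show "mat_inv A \<in> carrier_mat n n" "A * mat_inv A = 1\<^sub>m n" "mat_inv A * A = 1\<^sub>m n"
    using mat_inverse(2)[OF A] by (auto simp: mat_inv_def)
qed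

text \<open>A repeated index would make two rows of \<open>A(I,I)\<close> equal.\<close>

lemma distinct_if_select_both_invertible:
  assumes "invertible_mat (select_both A I)"
  shows "distinct I"
  unfolding distinct_conv_nth
proof (intro allI impI)
  fix a b assume ab: "a < length I" "b < length I" "a \<noteq> b"
  let ?B = "select_both A I" and ?k = "length I"
  have B: "?B \<in> carrier_mat ?k ?k" by (simp add: select_both_def)
  note W = mat_inv_correct[OF B assms]
  show "I ! a \<noteq> I ! b"
  proof
    assume "I ! a = I ! b"
    then have "row ?B a = row ?B b" using ab by (auto simp: select_both_def)
    then have "(?B * mat_inv ?B) $$ (a, b) = (?B * mat_inv ?B) $$ (b, b)"
      using ab B W(1) by simp
    then show False using ab W(2) by simp
  qed
qed

lemma col_mat_of_selected_rows:
  assumes "U \<in> carrier_mat m n" and "a < length I" and "I ! a < m"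
  shows "col (mat_of_cols n (map (row U) I)) a = row U (I ! a)"
  by (rule col_mat_of_cols[THEN trans]) (use assms in \<open>auto simp: row_carrier_vec\<close>)

lemma gram_entry:
  fixes U M :: "real mat"
  assumes U: "U \<in> carrier_mat m n" and M: "M \<in> carrier_mat n n" and ij: "i < m" "j < m"
  shows "(U * M * U\<^sup>T) $$ (i, j) = row U i \<bullet> (M *\<^sub>v row U j)"
proof -
  have "(U * M * U\<^sup>T) $$ (i, j) = (U * (M * U\<^sup>T)) $$ (i, j)"
    using U M by (simp add: assoc_mult_mat)
  also have "\<dots> = row U i \<bullet> col (M * U\<^sup>T) j"
    using U M ij by simp
  also have "col (M * U\<^sup>T) j = M *\<^sub>v row U j"
    using U M ij by (intro eq_vecI) auto
  finally show ?thesis .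
qed

section \<open>Schur complements as least-squares errors\<close>

text \<open>
  A solution \<open>d\<close> of the normal equations \<open>X\<^sup>T M (u - X d) = 0\<close> minimises the form of \<open>M\<close> at
  \<open>u - X c\<close>. By the normal equations the minimum equals \<open>u \<bullet> M (u - X d)\<close>, which is the form in
  which a Schur complement produces it.
\<close>

lemma weighted_least_squares:
  fixes M X :: "real mat"
  assumes M: "M \<in> carrier_mat n n" and X: "X \<in> carrier_mat n k"
    and sym: "M\<^sup>T = M" and psd: "\<And>x. x \<in> carrier_vec n \<Longrightarrow> 0 \<le> x \<bullet> (M *\<^sub>v x)"
    and u: "u \<in> carrier_vec n" and c: "c \<in> carrier_vec k" and d: "d \<in> carrier_vec k"
    and normal: "X\<^sup>T *\<^sub>v (M *\<^sub>v (u - X *\<^sub>v d)) = 0\<^sub>v k"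
  shows "u \<bullet> (M *\<^sub>v (u - X *\<^sub>v d)) \<le> (u - X *\<^sub>v c) \<bullet> (M *\<^sub>v (u - X *\<^sub>v c))"
proof -
  define y where "y = u - X *\<^sub>v d"
  define z where "z = X *\<^sub>v (d - c)"
  have y: "y \<in> carrier_vec n" and z: "z \<in> carrier_vec n"
    using u X c d by (auto simp: y_def z_def)
  have orth: "(X *\<^sub>v e) \<bullet> (M *\<^sub>v y) = 0" if e: "e \<in> carrier_vec k" for e
  proof -
    have "(X *\<^sub>v e) \<bullet> (M *\<^sub>v y) = (M *\<^sub>v y) \<bullet> (X *\<^sub>v e)"
      by (rule comm_scalar_prod[of _ n]) (use M X e y in auto)
    also have "\<dots> = (X\<^sup>T *\<^sub>v (M *\<^sub>v y)) \<bullet> e"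
      using M X e y by (intro transpose_vec_mult_scalar[symmetric]) auto
    finally show ?thesis using normal e by (simp add: y_def)
  qed
  \<comment> \<open>Pythagoras: \<open>u - X c = y + z\<close>, and the residual \<open>y\<close> is \<open>M\<close>-orthogonal to the range of \<open>X\<close>.\<close>
  have zy: "z \<bullet> (M *\<^sub>v y) = 0" using orth c d by (simp add: z_def)
  have "y \<bullet> (M *\<^sub>v z) = (M *\<^sub>v y) \<bullet> z"
    using transpose_vec_mult_scalar[OF M z y] sym by simp
  then have yz: "y \<bullet> (M *\<^sub>v z) = 0"
    using zy M y z comm_scalar_prod[of "M *\<^sub>v y" n z] by simp
  have uy: "u \<bullet> (M *\<^sub>v y) = y \<bullet> (M *\<^sub>v y)"
  proof -
    have "y \<bullet> (M *\<^sub>v y) = u \<bullet> (M *\<^sub>v y) - (X *\<^sub>v d) \<bullet> (M *\<^sub>v y)"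
      unfolding y_def using M X u d by (intro minus_scalar_prod_distrib) auto
    then show ?thesis using orth[OF d] by simp
  qed
  have "u - X *\<^sub>v c = y + z"
    using X u c d unfolding y_def z_def
    by (subst mult_minus_distrib_mat_vec[OF X]) (auto intro!: eq_vecI)
  then have "(u - X *\<^sub>v c) \<bullet> (M *\<^sub>v (u - X *\<^sub>v c)) = (y + z) \<bullet> (M *\<^sub>v y + M *\<^sub>v z)"
    using M y z by (simp add: mult_add_distrib_mat_vec)
  also have "\<dots> = y \<bullet> (M *\<^sub>v y) + y \<bullet> (M *\<^sub>v z) + (z \<bullet> (M *\<^sub>v y) + z \<bullet> (M *\<^sub>v z))"
    using M y z by (simp add: add_scalar_prod_distrib[of _ n] scalar_prod_add_distrib[of _ n])
  also have "\<dots> \<ge> u \<bullet> (M *\<^sub>v y)"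
    using psd[OF z] by (simp add: yz zy uy)
  finally show ?thesis by (simp add: y_def)
qed

text \<open>
  With \<open>r = X\<^sup>T M u\<^sub>j\<close>, which is both the \<open>j\<close>-th column of \<open>A(I,:)\<close> and the \<open>j\<close>-th row of
  \<open>A(:,I)\<close>, the vector \<open>d = A(I,I)\<inverse> r\<close> solves the normal equations for \<open>u\<^sub>j\<close>, and the diagonal
  entry \<open>A\<^sub>j\<^sub>j - r \<bullet> d\<close> is the corresponding minimum.
\<close>

lemma schur_complement_diag_le:
  fixes U M A X :: "real mat" and I :: "nat list"
  defines "S \<equiv> A - select_cols A I * mat_inv (select_both A I) * select_rows A I"
  assumes U: "U \<in> carrier_mat m n" and M: "M \<in> carrier_mat n n"
    and sym: "M\<^sup>T = M" and psd: "\<And>x. x \<in> carrier_vec n \<Longrightarrow> 0 \<le> x \<bullet> (M *\<^sub>v x)"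
    and A_eq: "A = U * M * U\<^sup>T"
    and I_range: "set I \<subseteq> {..<m}"
    and inv: "invertible_mat (select_both A I)"
    and X_eq: "X = mat_of_cols n (map (row U) I)"
    and j: "j < m" and c: "c \<in> carrier_vec (length I)"
  shows "S $$ (j, j) \<le> (row U j - X *\<^sub>v c) \<bullet> (M *\<^sub>v (row U j - X *\<^sub>v c))"
proof -
  let ?k = "length I" and ?B = "select_both A I" and ?u = "row U j"
  define W where "W = mat_inv ?B"
  have A: "A \<in> carrier_mat m m" using U M A_eq by simp
  have X: "X \<in> carrier_mat n ?k"
    unfolding X_eq using mat_of_cols_carrier(1)[of n "map (row U) I"] by simp
  have B: "?B \<in> carrier_mat ?k ?k" by (simp add: select_both_def)
  note W = mat_inv_correct[OF B inv, folded W_def]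
  have u: "?u \<in> carrier_vec n" using U j by simp
  have Ia: "I ! a < m" if "a < ?k" for a
    using that I_range nth_mem by blast
  have col_X: "col X a = row U (I ! a)" if "a < ?k" for a
    using col_mat_of_selected_rows[OF U] that Ia by (simp add: X_eq)
  have entry: "A $$ (i, i') = row U i \<bullet> (M *\<^sub>v row U i')" if "i < m" "i' < m" for i i'
    unfolding A_eq by (rule gram_entry[OF U M that])
  have A_sym: "A $$ (i, i') = A $$ (i', i)" if ii': "i < m" "i' < m" for i i'
  proof -
    have r: "row U i \<in> carrier_vec n" "row U i' \<in> carrier_vec n" using U ii' by auto
    then have "row U i \<bullet> (M *\<^sub>v row U i') = (M *\<^sub>v row U i) \<bullet> row U i'"
      using transpose_vec_mult_scalar[OF M r(2,1)] sym by simp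
    also have "\<dots> = row U i' \<bullet> (M *\<^sub>v row U i)"
      by (rule comm_scalar_prod[of _ n]) (use M r in auto)
    finally show ?thesis using ii' by (simp add: entry)
  qed
  have B_eq: "?B = X\<^sup>T * (M * X)"
  proof (rule eq_matI)
    fix a b assume "a < dim_row (X\<^sup>T * (M * X))" "b < dim_col (X\<^sup>T * (M * X))"
    then have ab: "a < ?k" "b < ?k" using X by auto
    have "(X\<^sup>T * (M * X)) $$ (a, b) = col X a \<bullet> col (M * X) b"
      using ab X M by simp
    also have "col (M * X) b = M *\<^sub>v col X b"
      using ab X M by (intro eq_vecI) auto
    finally show "?B $$ (a, b) = (X\<^sup>T * (M * X)) $$ (a, b)"
      using ab Ia by (simp add: select_both_def col_X entry)
  qed (use X in \<open>auto simp: select_both_def\<close>)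
  define r where "r = X\<^sup>T *\<^sub>v (M *\<^sub>v ?u)"
  have r: "r \<in> carrier_vec ?k"
    unfolding r_def by (rule mult_mat_vec_carrier[of _ ?k n]) (use X M u in auto)
  have r_nth: "r $ a = A $$ (I ! a, j)" if "a < ?k" for a
    using that X Ia j by (simp add: r_def col_X entry)
  define d where "d = W *\<^sub>v r"
  have d: "d \<in> carrier_vec ?k" using W r by (simp add: d_def)
  have "X\<^sup>T *\<^sub>v (M *\<^sub>v (X *\<^sub>v d)) = ?B *\<^sub>v d"
  proof -
    have "?B *\<^sub>v d = X\<^sup>T *\<^sub>v ((M * X) *\<^sub>v d)"
      unfolding B_eq by (rule assoc_mult_mat_vec[of _ ?k n]) (use X M d in auto)
    then show ?thesis
      using assoc_mult_mat_vec[OF M X d] by simp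
  qed
  also have "\<dots> = (?B * W) *\<^sub>v r"
    unfolding d_def by (rule assoc_mult_mat_vec[symmetric, OF B W(1) r])
  finally have XMXd: "X\<^sup>T *\<^sub>v (M *\<^sub>v (X *\<^sub>v d)) = r"
    using W(2) r by simp
  have normal: "X\<^sup>T *\<^sub>v (M *\<^sub>v (?u - X *\<^sub>v d)) = 0\<^sub>v ?k"
  proof -
    have "X\<^sup>T *\<^sub>v (M *\<^sub>v (?u - X *\<^sub>v d)) = X\<^sup>T *\<^sub>v (M *\<^sub>v ?u - M *\<^sub>v (X *\<^sub>v d))"
      using X M u d by (subst mult_minus_distrib_mat_vec[OF M]) auto
    also have "\<dots> = r - X\<^sup>T *\<^sub>v (M *\<^sub>v (X *\<^sub>v d))"
      unfolding r_def using X M u d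
      by (intro mult_minus_distrib_mat_vec[of _ ?k n]) auto
    finally show ?thesis using XMXd r by simp
  qed
  have "S $$ (j, j) = A $$ (j, j) - r \<bullet> d"
  proof -
    let ?C = "select_cols A I" and ?R = "select_rows A I"
    have C: "?C \<in> carrier_mat m ?k" and R: "?R \<in> carrier_mat ?k m"
      using A by (auto simp: select_cols_def select_rows_def)
    have "(?C * W * ?R) $$ (j, j) = (?C * (W * ?R)) $$ (j, j)"
      using C R W by (simp add: assoc_mult_mat)
    also have "\<dots> = row ?C j \<bullet> col (W * ?R) j"
      using C R W j by simp
    also have "col (W * ?R) j = W *\<^sub>v col ?R j"
      using C R W j by (intro eq_vecI) auto
    also have "col ?R j = r"
      using R r j A by (intro eq_vecI) (auto simp: r_nth select_rows_def)
    also have "row ?C j = r"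
      using C r j A Ia by (intro eq_vecI) (auto simp: r_nth select_cols_def A_sym[OF j])
    finally have "(?C * W * ?R) $$ (j, j) = r \<bullet> d" by (simp add: d_def)
    moreover have "S $$ (j, j) = A $$ (j, j) - (?C * W * ?R) $$ (j, j)"
      unfolding S_def W_def[symmetric] using A C R W j by simp
    ultimately show ?thesis by simp
  qed
  also have "r \<bullet> d = ?u \<bullet> (M *\<^sub>v (X *\<^sub>v d))"
  proof -
    have "r \<bullet> d = (M *\<^sub>v ?u) \<bullet> (X *\<^sub>v d)"
      unfolding r_def using X M u d by (intro transpose_vec_mult_scalar) auto
    also have "\<dots> = ?u \<bullet> (M *\<^sub>v (X *\<^sub>v d))"
      using transpose_vec_mult_scalar[OF M, of "X *\<^sub>v d" ?u] X u d sym by simp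
    finally show ?thesis .
  qed
  also have "A $$ (j, j) = ?u \<bullet> (M *\<^sub>v ?u)" using j by (simp add: entry)
  also have "?u \<bullet> (M *\<^sub>v ?u) - ?u \<bullet> (M *\<^sub>v (X *\<^sub>v d)) = ?u \<bullet> (M *\<^sub>v (?u - X *\<^sub>v d))"
  proof -
    have Xd: "X *\<^sub>v d \<in> carrier_vec n" using X d by simp
    have "?u \<bullet> (M *\<^sub>v ?u - M *\<^sub>v (X *\<^sub>v d)) = ?u \<bullet> (M *\<^sub>v ?u) - ?u \<bullet> (M *\<^sub>v (X *\<^sub>v d))"
      by (rule scalar_prod_minus_distrib[of _ n]) (use M u Xd in auto)
    then show ?thesis
      by (simp add: mult_minus_distrib_mat_vec[OF M u Xd])
  qed
  also have "\<dots> \<le> (?u - X *\<^sub>v c) \<bullet> (M *\<^sub>v (?u - X *\<^sub>v c))"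
    by (rule weighted_least_squares[OF M X sym psd u c d normal])
  finally show ?thesis .
qed

lemma mat_diag_quadratic_form:
  fixes \<sigma> :: "nat \<Rightarrow> real"
  assumes x: "x \<in> carrier_vec n"
  shows "x \<bullet> (mat_diag n \<sigma> *\<^sub>v x) = (\<Sum>q<n. \<sigma> q * (x $ q)\<^sup>2)"
proof -
  have "(mat_diag n \<sigma> *\<^sub>v x) $ q = \<sigma> q * x $ q" if "q < n" for q
  proof -
    have "(mat_diag n \<sigma> *\<^sub>v x) $ q = (\<Sum>p<n. (if q = p then \<sigma> p else 0) * x $ p)"
      using that x by (simp add: mat_diag_def scalar_prod_def atLeast0LessThan)
    also have "\<dots> = (\<Sum>p<n. if p = q then \<sigma> q * x $ q else 0)"
      by (intro sum.cong) auto
    finally show ?thesis using that by simp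
  qed
  moreover have "dim_vec (mat_diag n \<sigma> *\<^sub>v x) = n" by (simp add: mat_diag_def)
  ultimately show ?thesis
    by (simp add: scalar_prod_def atLeast0LessThan power2_eq_square mult_ac)
qed

section \<open>Interpolating the leading coordinates\<close>

lemma vec_norm2_mult_orthonormal_cols:
  assumes X: "X \<in> carrier_mat n k" and orth: "X\<^sup>T * X = 1\<^sub>m k" and c: "c \<in> carrier_vec k"
  shows "vec_norm2 (X *\<^sub>v c) = vec_norm2 c"
proof -
  have "(X *\<^sub>v c) \<bullet> (X *\<^sub>v c) = (X\<^sup>T *\<^sub>v (X *\<^sub>v c)) \<bullet> c"
    using X c by (intro transpose_vec_mult_scalar[symmetric]) auto
  also have "X\<^sup>T *\<^sub>v (X *\<^sub>v c) = c"
    using X c orth assoc_mult_mat_vec[of "X\<^sup>T" k n X k c] by simp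
  finally show ?thesis by (simp add: vec_norm2_def)
qed

lemma coord_proj_carrier: "coord_proj k n \<in> carrier_mat k n"
  by (simp add: coord_proj_def)

lemma coord_proj_nth:
  assumes "k \<le> n" and "x \<in> carrier_vec n" and i: "i < k"
  shows "(coord_proj k n *\<^sub>v x) $ i = x $ i"
proof -
  have "(coord_proj k n *\<^sub>v x) $ i = (\<Sum>j<n. (if i = j then 1 else 0) * x $ j)"
    using assms by (simp add: coord_proj_def scalar_prod_def atLeast0LessThan)
  also have "\<dots> = (\<Sum>j<n. if j = i then x $ i else 0)"
    by (intro sum.cong) auto
  finally show ?thesis using assms by simp
qed

lemma vec_norm2_coord_proj_le:
  assumes "k \<le> n" and "x \<in> carrier_vec n"
  shows "vec_norm2 (coord_proj k n *\<^sub>v x) \<le> vec_norm2 x"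
proof -
  have "(\<Sum>i<k. ((coord_proj k n *\<^sub>v x) $ i)\<^sup>2) = (\<Sum>i<k. (x $ i)\<^sup>2)"
    using assms by (simp add: coord_proj_nth)
  also have "\<dots> \<le> (\<Sum>i<n. (x $ i)\<^sup>2)"
    using assms by (intro sum_mono2) auto
  finally show ?thesis
    using assms coord_proj_carrier[of k n] by (simp add: vec_norm2_L2_set L2_set_def)
qed

text \<open>
  The coefficients are \<open>c = U0\<inverse> P\<^sub>k u\<close>: then \<open>P\<^sub>k X c = U0 c = P\<^sub>k u\<close>, so \<open>X c\<close> interpolates \<open>u\<close> in
  the first \<open>k\<close> coordinates.
\<close>

lemma interpolating_coefficients:
  fixes X U0 :: "real mat"
  assumes kn: "k \<le> n" and X: "X \<in> carrier_mat n k" and orth: "X\<^sup>T * X = 1\<^sub>m k"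
    and U0: "U0 = coord_proj k n * X" and inv: "invertible_mat U0"
    and u: "u \<in> carrier_vec n" and unit: "vec_norm2 u \<le> 1"
  obtains c where "c \<in> carrier_vec k"
    and "\<And>q. q < k \<Longrightarrow> (u - X *\<^sub>v c) $ q = 0"
    and "vec_norm2 (u - X *\<^sub>v c) \<le> 1 + spectral_norm (mat_inv U0)"
proof
  let ?P = "coord_proj k n" and ?V = "mat_inv U0"
  note P = coord_proj_carrier[of k n]
  have U0c: "U0 \<in> carrier_mat k k" using X P unfolding U0 by simp
  note V = mat_inv_correct[OF U0c inv]
  define c where "c = ?V *\<^sub>v (?P *\<^sub>v u)"
  have Pu: "?P *\<^sub>v u \<in> carrier_vec k" using P u by simp
  show c: "c \<in> carrier_vec k" using V(1) Pu by (simp add: c_def)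
  have Xc: "X *\<^sub>v c \<in> carrier_vec n" using X c by simp
  have "?P *\<^sub>v (X *\<^sub>v c) = U0 *\<^sub>v c"
    unfolding U0 using P X c by simp
  also have "\<dots> = (U0 * ?V) *\<^sub>v (?P *\<^sub>v u)"
    unfolding c_def by (rule assoc_mult_mat_vec[symmetric, OF U0c V(1) Pu])
  finally have PXc: "?P *\<^sub>v (X *\<^sub>v c) = ?P *\<^sub>v u" using V(2) Pu by simp
  show "(u - X *\<^sub>v c) $ q = 0" if q: "q < k" for q
    using coord_proj_nth[OF kn u q] coord_proj_nth[OF kn Xc q] PXc q kn u X c by simp
  have "vec_norm2 (X *\<^sub>v c) = vec_norm2 c"
    by (rule vec_norm2_mult_orthonormal_cols[OF X orth c])
  also have "\<dots> \<le> spectral_norm ?V"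
    unfolding c_def
    by (rule vec_norm2_mult_le_spectral_norm)
      (use Pu V(1) order_trans[OF vec_norm2_coord_proj_le[OF kn u] unit] in auto)
  finally show "vec_norm2 (u - X *\<^sub>v c) \<le> 1 + spectral_norm ?V"
    using vec_norm2_minus_le[OF u Xc] unit by simp
qed

section \<open>The trace bound\<close>

theorem theorem2p11:
  fixes n k :: nat
    and A U X U0 :: "real mat"
    and \<sigma> :: "nat \<Rightarrow> real"
    and I :: "nat list"
  assumes U_orth: "real_orthogonal_mat n U"
    and \<sigma>_decreasing: "\<And>i j. i \<le> j \<Longrightarrow> j < n \<Longrightarrow> \<sigma> j \<le> \<sigma> i"
    and \<sigma>_nonneg: "\<And>i. i < n \<Longrightarrow> 0 \<le> \<sigma> i"
    and A_eq: "A = U * mat_diag n \<sigma> * U\<^sup>T"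
    and I_length: "length I = k"
    and I_range: "set I \<subseteq> {..<n}"
    and AII_nonsing: "invertible_mat (select_both A I)"
    and X_eq: "X = mat_of_cols n (map (row U) I)"
    and U0_eq: "U0 = coord_proj k n * X"
    and U0_nonsing: "invertible_mat U0"
  shows "mat_trace (A - select_cols A I * mat_inv (select_both A I) * select_rows A I)
      \<le> (real n - real k) * (1 + spectral_norm (mat_inv U0))\<^sup>2 * (\<Sum>q = k..<n. \<sigma> q)"
proof -
  define S where "S = A - select_cols A I * mat_inv (select_both A I) * select_rows A I"
  define T where "T = (1 + spectral_norm (mat_inv U0))\<^sup>2 * (\<Sum>q = k..<n. \<sigma> q)"
  let ?D = "mat_diag n \<sigma>"
  have U: "U \<in> carrier_mat n n" and UUt: "U * U\<^sup>T = 1\<^sub>m n"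
    using U_orth by (auto simp: real_orthogonal_mat_def)
  have D: "?D \<in> carrier_mat n n" by simp
  have D_sym: "?D\<^sup>T = ?D" by (auto simp: mat_diag_def)
  have D_psd: "0 \<le> x \<bullet> (?D *\<^sub>v x)" if "x \<in> carrier_vec n" for x
    using that \<sigma>_nonneg by (auto simp: mat_diag_quadratic_form intro!: sum_nonneg)
  have dist: "distinct I"
    using AII_nonsing by (rule distinct_if_select_both_invertible)
  have card_I: "card (set I) = k"
    using dist I_length by (simp add: distinct_card)
  have kn: "k \<le> n"
    using card_mono[OF _ I_range] card_I by simp
  have X: "X \<in> carrier_mat n k"
    using mat_of_cols_carrier(1)[of n "map (row U) I"] I_length by (simp add: X_eq)
  have Ia: "I ! a < n" if "a < k" for a
    using that I_range I_length nth_mem by blast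
  have col_X: "col X a = row U (I ! a)" if "a < k" for a
    using col_mat_of_selected_rows[OF U] that Ia I_length by (simp add: X_eq)
  have rows: "row U i \<bullet> row U j = (if i = j then 1 else 0)" if "i < n" "j < n" for i j
    using arg_cong[OF UUt, of "\<lambda>M. M $$ (i, j)"] that U by simp
  have XtX: "X\<^sup>T * X = 1\<^sub>m k"
    by (rule eq_matI)
      (use X Ia dist I_length in \<open>auto simp: col_X rows nth_eq_iff_index_eq\<close>)
  have diag_le: "S $$ (j, j) \<le> (row U j - X *\<^sub>v c) \<bullet> (?D *\<^sub>v (row U j - X *\<^sub>v c))"
    if "j < n" "c \<in> carrier_vec k" for j c
    unfolding S_def
    by (rule schur_complement_diag_le[OF U D D_sym D_psd A_eq I_range AII_nonsing X_eq])
      (use that I_length in auto)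
  have selected_entry: "S $$ (j, j) \<le> 0" if jI: "j \<in> set I" for j
  proof -
    obtain p where p: "p < k" "I ! p = j"
      using jI I_length by (auto simp: in_set_conv_nth)
    have "X *\<^sub>v unit_vec k p = col X p"
      using X p scalar_prod_right_unit[of p k] by (intro eq_vecI) auto
    then have "X *\<^sub>v unit_vec k p = row U j"
      using p by (simp add: col_X)
    then have "row U j - X *\<^sub>v unit_vec k p = 0\<^sub>v n"
      using U by auto
    then show ?thesis
      using diag_le[of j "unit_vec k p"] I_range jI D by (auto simp: mat_diag_quadratic_form)
  qed
  have every_entry: "S $$ (j, j) \<le> T" if j: "j < n" for j
  proof -
    let ?u = "row U j"
    have u: "?u \<in> carrier_vec n" using U j by simp
    have "vec_norm2 ?u \<le> 1" using rows[OF j j] by (simp add: vec_norm2_def)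
    then obtain c where c: "c \<in> carrier_vec k"
      and zero: "\<And>q. q < k \<Longrightarrow> (?u - X *\<^sub>v c) $ q = 0"
      and le: "vec_norm2 (?u - X *\<^sub>v c) \<le> 1 + spectral_norm (mat_inv U0)"
      using interpolating_coefficients[OF kn X XtX U0_eq U0_nonsing u] by blast
    define e where "e = ?u - X *\<^sub>v c"
    have e: "e \<in> carrier_vec n" using u X c by (simp add: e_def)
    have e_le: "(e $ q)\<^sup>2 \<le> (1 + spectral_norm (mat_inv U0))\<^sup>2" if "q < n" for q
    proof -
      have "(e $ q)\<^sup>2 \<le> (vec_norm2 e)\<^sup>2"
        using that e by (intro square_entry_le_vec_norm2) simp
      also have "\<dots> \<le> (1 + spectral_norm (mat_inv U0))\<^sup>2"
        using le vec_norm2_nonneg[of e] by (intro power_mono) (auto simp: e_def)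
      finally show ?thesis .
    qed
    have "S $$ (j, j) \<le> e \<bullet> (?D *\<^sub>v e)"
      using diag_le[OF j c] by (simp add: e_def)
    also have "\<dots> = (\<Sum>q<n. \<sigma> q * (e $ q)\<^sup>2)"
      by (rule mat_diag_quadratic_form[OF e])
    also have "\<dots> = (\<Sum>q=k..<n. \<sigma> q * (e $ q)\<^sup>2)"
      using zero by (intro sum.mono_neutral_right) (auto simp: e_def)
    also have "\<dots> \<le> (\<Sum>q=k..<n. \<sigma> q * (1 + spectral_norm (mat_inv U0))\<^sup>2)"
      using \<sigma>_nonneg e_le by (intro sum_mono mult_left_mono) auto
    also have "\<dots> = T"
      by (simp add: T_def sum_distrib_right mult.commute)
    finally show ?thesis .
  qed
  have "dim_row S = n"
    using U by (simp add: S_def A_eq select_cols_def)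
  then have "mat_trace S = (\<Sum>j<n. S $$ (j, j))"
    by (simp add: mat_trace_def)
  also have "\<dots> = (\<Sum>j\<in>{..<n} - set I. S $$ (j, j)) + (\<Sum>j\<in>set I. S $$ (j, j))"
    using I_range by (intro sum.subset_diff) auto
  also have "\<dots> \<le> (\<Sum>j\<in>{..<n} - set I. T) + 0"
    using selected_entry every_entry by (intro add_mono sum_mono sum_nonpos) auto
  also have "\<dots> = (real n - real k) * T"
    using I_range card_I kn by (simp add: card_Diff_subset)
  finally show ?thesis
    by (simp add: S_def T_def mult.assoc)
qed

end
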